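(* Let the chiral-type system $\Delta^\alpha\equiv U^\alpha_{xy}+G^\alpha_{\beta\gamma}U^\beta_xU^\gamma_y+Q^\alpha=0$ ($\alpha=1,\dots,n$) admit a matrix $\mathfrak g$-valued Lax representation with functions $A_\alpha,B_\alpha,M,N$ and characteristic element $S_\alpha=A_\alpha-B_\alpha$, as defined in the context. Let $f$ be a symmetric ad-invariant $p$-form on the Lie algebra $\mathfrak g$ and let $1\le k\le p$. Then the tensor field $$K_{\alpha_1\alpha_2\dots\alpha_k}=f([S_{\alpha_1},M],[S_{\alpha_2},M],\dots,[S_{\alpha_k},M],\underbrace{M,\dots,M}_{p-k})$$ satisfies, for all indices, $$\nabla_\gamma K_{\alpha_1\alpha_2\dots\alpha_k}=0.$$
   Context: Greek indices range over $1,\dots,n$; repeated indices are summed. $x,y$ are the independent variables, $U^1,\dots,U^n$ the dependent variables; subscripts $x,y$ denote partial derivatives, $D_x,D_y$ are total derivatives, and a comma denotes $P_{,\alpha}=\partial P/\partial U^\alpha$. The coefficients $G^\alpha_{\beta\gamma}$ (not assumed symmetric in $\beta,\gamma$) and $Q^\alpha$ are smooth functions of $U=(U^1,\dots,U^n)$. Lax representation: $\mathfrak g$ is a (finite-dimensional) matrix Lie algebra, $A_\alpha,B_\alpha$ ($\alpha=1,\dots,n$), $M,N$ are smooth $\mathfrak g$-valued functions of $U^1,\dots,U^n$, and with $$\widetilde A=A_\alpha U^\alpha_x+\lambda M,\qquad \widetilde B=B_\alpha U^\alpha_y+\tfrac1\lambda N,\qquad S_\alpha=A_\alpha-B_\alpha,$$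 the identity $D_y\widetilde A-D_x\widetilde B+[\widetilde A,\widetilde B]=S_\alpha\Delta^\alpha$ holds identically in the parameter $\lambda\neq0$ and in the variables $U^\alpha$ and their derivatives. $S_1,\dots,S_n$ (the characteristic element) are assumed linearly independent. Covariant derivative: $\nabla_\beta$ is the covariant derivative with respect to the connection with coefficients $G^\gamma_{\alpha\beta}$, with the convention $\nabla_\beta T_{\alpha_1\dots\alpha_k}=T_{\alpha_1\dots\alpha_k,\beta}-\sum_{i=1}^k G^\gamma_{\alpha_i\beta}\,T_{\alpha_1\dots\alpha_{i-1}\gamma\alpha_{i+1}\dots\alpha_k}$. A symmetric $p$-form $f$ on $\mathfrak g$ is a symmetric $p$-linear scalar-valued form; it is ad-invariant if $\sum_{i=1}^p f(X_1,\dots,[Y,X_i],\dots,X_p)=0$ for all $Y,X_1,\dots,X_p\in\mathfrak g$. *)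

theory Defs
  imports "HOL-Analysis.Analysis"
begin

primrec Ck_on :: "nat \<Rightarrow> 'a::real_normed_vector set \<Rightarrow> ('a \<Rightarrow> 'b::real_normed_vector) \<Rightarrow> bool" where
  "Ck_on 0 \<Omega> P \<longleftrightarrow> continuous_on \<Omega> P"
| "Ck_on (Suc k) \<Omega> P \<longleftrightarrow>
     (\<forall>u\<in>\<Omega>. P differentiable (at u)) \<and>
     (\<forall>v. Ck_on k \<Omega> (\<lambda>u. frechet_derivative P (at u) v))"

text \<open>Only meaningful for open \<open>\<Omega>\<close>, since derivatives are taken at (not within) the points of \<open>\<Omega>\<close>.\<close>

definition smooth_on :: "'a::real_normed_vector set \<Rightarrow> ('a \<Rightarrow> 'b::real_normed_vector) \<Rightarrow> bool" where
  "smooth_on \<Omega> P \<longleftrightarrow> (\<forall>k. Ck_on k \<Omega> P)"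

text \<open>\<open>partial_deriv \<alpha> P\<close> is \<open>\<partial>P / \<partial>U\<^sup>\<alpha>\<close>.\<close>

definition partial_deriv ::
    "'n::finite \<Rightarrow> (real^'n \<Rightarrow> 'b::real_normed_vector) \<Rightarrow> real^'n \<Rightarrow> 'b" where
  "partial_deriv \<alpha> P u = frechet_derivative P (at u) (axis \<alpha> 1)"

text \<open>
  Points of the first jet space are triples \<open>(U, U\<^sub>x, U\<^sub>y)\<close>, points of the second jet space are
  sextuples \<open>(U, U\<^sub>x, U\<^sub>y, U\<^sub>x\<^sub>x, U\<^sub>x\<^sub>y, U\<^sub>y\<^sub>y)\<close>.  For a differentiable \<open>F\<close>, applying its Frechet derivative
  to \<open>(U\<^sub>x, U\<^sub>x\<^sub>x, U\<^sub>x\<^sub>y)\<close> is the total derivative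
  \<open>U\<^sub>x\<^sup>\<alpha> \<partial>F/\<partial>U\<^sup>\<alpha> + U\<^sub>x\<^sub>x\<^sup>\<alpha> \<partial>F/\<partial>U\<^sub>x\<^sup>\<alpha> + U\<^sub>x\<^sub>y\<^sup>\<alpha> \<partial>F/\<partial>U\<^sub>y\<^sup>\<alpha>\<close>; similarly for \<open>y\<close>.
\<close>

type_synonym 'n jet1 = "(real^'n) \<times> (real^'n) \<times> (real^'n)"
type_synonym 'n jet2 =
  "(real^'n) \<times> (real^'n) \<times> (real^'n) \<times> (real^'n) \<times> (real^'n) \<times> (real^'n)"

definition total_deriv_x ::
    "('n::finite jet1 \<Rightarrow> 'b::real_normed_vector) \<Rightarrow> 'n jet2 \<Rightarrow> 'b" where
  "total_deriv_x F = (\<lambda>(u, ux, uy, uxx, uxy, uyy).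
     frechet_derivative F (at (u, ux, uy)) (ux, uxx, uxy))"

definition total_deriv_y ::
    "('n::finite jet1 \<Rightarrow> 'b::real_normed_vector) \<Rightarrow> 'n jet2 \<Rightarrow> 'b" where
  "total_deriv_y F = (\<lambda>(u, ux, uy, uxx, uxy, uyy).
     frechet_derivative F (at (u, ux, uy)) (uy, uxy, uyy))"

text \<open>\<open>G \<alpha> \<beta> \<gamma>\<close> stands for \<open>G\<^sup>\<alpha>\<^sub>\<beta>\<^sub>\<gamma>\<close>: the contravariant index comes first.\<close>

definition chiral_system ::
    "('n \<Rightarrow> 'n \<Rightarrow> 'n \<Rightarrow> real^'n \<Rightarrow> real) \<Rightarrow> ('n \<Rightarrow> real^'n \<Rightarrow> real)
      \<Rightarrow> 'n::finite \<Rightarrow> 'n jet2 \<Rightarrow> real" where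
  "chiral_system G Q \<alpha> = (\<lambda>(u, ux, uy, uxx, uxy, uyy).
     uxy $ \<alpha> + (\<Sum>\<beta>\<in>UNIV. \<Sum>\<gamma>\<in>UNIV. G \<alpha> \<beta> \<gamma> u * ux $ \<beta> * uy $ \<gamma>) + Q \<alpha> u)"

definition commutator :: "'k::ring_1^'m^'m \<Rightarrow> 'k^'m^'m \<Rightarrow> 'k^'m^'m" where
  "commutator X Y = X ** Y - Y ** X"

text \<open>
  The entries lie in \<open>'k\<close> (the reals or the complex numbers); \<open>\<gg>\<close> only has to be closed under
  real linear combinations, so real and complex matrix Lie algebras are both covered.
\<close>

definition matrix_lie_algebra ::
    "('k::{real_normed_field,euclidean_space}^'m::finite^'m) set \<Rightarrow> bool" where
  "matrix_lie_algebra \<gg> \<longleftrightarrow> subspace \<gg> \<and> (\<forall>X\<in>\<gg>. \<forall>Y\<in>\<gg>. commutator X Y \<in> \<gg>)"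

definition lax_A ::
    "('n::finite \<Rightarrow> real^'n \<Rightarrow> 'b::real_normed_vector) \<Rightarrow> (real^'n \<Rightarrow> 'b) \<Rightarrow> real \<Rightarrow> 'n jet1 \<Rightarrow> 'b" where
  "lax_A A M lam = (\<lambda>(u, ux, uy). (\<Sum>\<alpha>\<in>UNIV. (ux $ \<alpha>) *\<^sub>R A \<alpha> u) + lam *\<^sub>R M u)"

definition lax_B ::
    "('n::finite \<Rightarrow> real^'n \<Rightarrow> 'b::real_normed_vector) \<Rightarrow> (real^'n \<Rightarrow> 'b) \<Rightarrow> real \<Rightarrow> 'n jet1 \<Rightarrow> 'b" where
  "lax_B B N lam = (\<lambda>(u, ux, uy). (\<Sum>\<alpha>\<in>UNIV. (uy $ \<alpha>) *\<^sub>R B \<alpha> u) + (1 / lam) *\<^sub>R N u)"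

definition characteristic_element ::
    "('n \<Rightarrow> real^'n \<Rightarrow> 'b::real_normed_vector) \<Rightarrow> ('n \<Rightarrow> real^'n \<Rightarrow> 'b) \<Rightarrow> 'n::finite \<Rightarrow> real^'n \<Rightarrow> 'b" where
  "characteristic_element A B \<alpha> u = A \<alpha> u - B \<alpha> u"

text \<open>
  Linear independence of the family \<open>S\<^sub>\<alpha>\<close> is required at every point of \<open>\<Omega>\<close>; injectivity is
  needed because the range does not see repeated members.
\<close>

definition lax_representation ::
    "(real^'n::finite) set
      \<Rightarrow> ('n \<Rightarrow> 'n \<Rightarrow> 'n \<Rightarrow> real^'n \<Rightarrow> real) \<Rightarrow> ('n \<Rightarrow> real^'n \<Rightarrow> real)
      \<Rightarrow> ('k::{real_normed_field,euclidean_space}^'m::finite^'m) set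
      \<Rightarrow> ('n \<Rightarrow> real^'n \<Rightarrow> 'k^'m^'m) \<Rightarrow> ('n \<Rightarrow> real^'n \<Rightarrow> 'k^'m^'m)
      \<Rightarrow> (real^'n \<Rightarrow> 'k^'m^'m) \<Rightarrow> (real^'n \<Rightarrow> 'k^'m^'m) \<Rightarrow> bool" where
  "lax_representation \<Omega> G Q \<gg> A B M N \<longleftrightarrow>
     (\<forall>\<alpha>. smooth_on \<Omega> (A \<alpha>) \<and> smooth_on \<Omega> (B \<alpha>)) \<and> smooth_on \<Omega> M \<and> smooth_on \<Omega> N \<and>
     (\<forall>u\<in>\<Omega>. (\<forall>\<alpha>. A \<alpha> u \<in> \<gg> \<and> B \<alpha> u \<in> \<gg>) \<and> M u \<in> \<gg> \<and> N u \<in> \<gg>) \<and>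
     (\<forall>u\<in>\<Omega>. inj (\<lambda>\<alpha>. characteristic_element A B \<alpha> u) \<and>
             independent (range (\<lambda>\<alpha>. characteristic_element A B \<alpha> u))) \<and>
     (\<forall>lam. lam \<noteq> 0 \<longrightarrow> (\<forall>u\<in>\<Omega>. \<forall>ux uy uxx uxy uyy.
        total_deriv_y (lax_A A M lam) (u, ux, uy, uxx, uxy, uyy)
        - total_deriv_x (lax_B B N lam) (u, ux, uy, uxx, uxy, uyy)
        + commutator (lax_A A M lam (u, ux, uy)) (lax_B B N lam (u, ux, uy))
        = (\<Sum>\<alpha>\<in>UNIV. chiral_system G Q \<alpha> (u, ux, uy, uxx, uxy, uyy)
                      *\<^sub>R characteristic_element A B \<alpha> u)))"

text \<open>A \<open>p\<close>-form on \<open>\<gg>\<close> is a function on lists of length \<open>p\<close> over \<open>\<gg>\<close>; other lists are ignored.\<close>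

definition symmetric_form ::
    "nat \<Rightarrow> 'v::real_vector set \<Rightarrow> ('v list \<Rightarrow> 'k::real_vector) \<Rightarrow> bool" where
  "symmetric_form p \<gg> f \<longleftrightarrow>
     (\<forall>Xs i X Y a b. length Xs = p \<and> set Xs \<subseteq> \<gg> \<and> i < p \<and> X \<in> \<gg> \<and> Y \<in> \<gg> \<longrightarrow>
        f (Xs[i := a *\<^sub>R X + b *\<^sub>R Y]) = a *\<^sub>R f (Xs[i := X]) + b *\<^sub>R f (Xs[i := Y])) \<and>
     (\<forall>Xs Ys. length Xs = p \<and> set Xs \<subseteq> \<gg> \<and> mset Xs = mset Ys \<longrightarrow> f Xs = f Ys)"

definition ad_invariant ::
    "nat \<Rightarrow> ('k::ring_1^'m::finite^'m) set \<Rightarrow> (('k^'m^'m) list \<Rightarrow> 'c::comm_monoid_add) \<Rightarrow> bool" where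
  "ad_invariant p \<gg> f \<longleftrightarrow>
     (\<forall>Y\<in>\<gg>. \<forall>Xs. length Xs = p \<and> set Xs \<subseteq> \<gg> \<longrightarrow>
        (\<Sum>i<p. f (Xs[i := commutator Y (Xs ! i)])) = 0)"

text \<open>
  A covariant tensor field of rank \<open>k\<close> is given by its components, indexed by lists of length \<open>k\<close>.
  In the connection coefficient the differentiation index is the second lower one, which matters
  because \<open>G\<close> need not be symmetric.
\<close>

definition covariant_deriv ::
    "('n \<Rightarrow> 'n \<Rightarrow> 'n \<Rightarrow> real^'n \<Rightarrow> real) \<Rightarrow> 'n::finite
      \<Rightarrow> ('n list \<Rightarrow> real^'n \<Rightarrow> 'b::real_normed_vector) \<Rightarrow> 'n list \<Rightarrow> real^'n \<Rightarrow> 'b" where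
  "covariant_deriv G \<beta> T \<alpha>s u =
     partial_deriv \<beta> (T \<alpha>s) u
     - (\<Sum>i<length \<alpha>s. \<Sum>\<gamma>\<in>UNIV. G \<gamma> (\<alpha>s ! i) \<beta> u *\<^sub>R T (\<alpha>s[i := \<gamma>]) u)"

definition lax_tensor ::
    "nat \<Rightarrow> (('k::ring_1^'m::finite^'m) list \<Rightarrow> 'c)
      \<Rightarrow> ('n \<Rightarrow> real^'n \<Rightarrow> 'k^'m^'m) \<Rightarrow> (real^'n \<Rightarrow> 'k^'m^'m)
      \<Rightarrow> 'n::finite list \<Rightarrow> real^'n \<Rightarrow> 'c" where
  "lax_tensor p f S M \<alpha>s u =
     f (map (\<lambda>\<alpha>. commutator (S \<alpha> u) (M u)) \<alpha>s @ replicate (p - length \<alpha>s) (M u))"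

end

theory Submission
  imports Defs
begin

text \<open>
  The coefficients of the Lax identity at \<open>\<lambda>\<close> and at \<open>U\<^sub>x\<^sup>\<beta> U\<^sub>y\<^sup>\<gamma>\<close> give \<open>M\<^sub>,\<^sub>\<beta> = [B\<^sub>\<beta>, M]\<close> and
  \<open>A\<^sub>\<beta>\<^sub>,\<^sub>\<gamma> - B\<^sub>\<gamma>\<^sub>,\<^sub>\<beta> + [A\<^sub>\<beta>, B\<^sub>\<gamma>] = G\<^sup>\<alpha>\<^sub>\<beta>\<^sub>\<gamma> S\<^sub>\<alpha>\<close>.  The compatibility condition \<open>M\<^sub>,\<^sub>\<beta>\<^sub>\<gamma> = M\<^sub>,\<^sub>\<gamma>\<^sub>\<beta>\<close> and the Jacobi
  identity then turn the second relation into \<open>\<nabla>\<^sub>\<gamma> [S\<^sub>\<alpha>, M] = [B\<^sub>\<gamma>, [S\<^sub>\<alpha>, M]]\<close>.  So \<open>\<nabla>\<^sub>\<gamma>\<close> acts on every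
  argument of \<open>f\<close> as \<open>ad B\<^sub>\<gamma>\<close>, and \<open>\<nabla>\<^sub>\<gamma> K\<close> vanishes by ad-invariance.
\<close>

subsection \<open>Symmetry of second derivatives\<close>

text \<open>With \<open>t *\<^sub>R b\<close> held fixed, the second difference is an increment
  along \<open>a\<close>. Differentiability of \<open>f' x a\<close> at \<open>u\<close> gives its
  rate as \<open>t *\<^sub>R Fa b\<close> up to o(t), and over a segment of parameter length
  \<open>t\<close> the error is o(t^2).\<close>

lemma second_difference_approx:
  fixes f :: "'a::real_normed_vector \<Rightarrow> 'b::real_normed_vector"
  assumes S: "open S" "u \<in> S"
    and f': "\<And>x. x \<in> S \<Longrightarrow> (f has_derivative f' x) (at x)"
    and Fa: "((\<lambda>x. f' x a) has_derivative Fa) (at u)"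
    and e: "e > 0"
  shows "eventually (\<lambda>t. norm (f (u + t *\<^sub>R a + t *\<^sub>R b) - f (u + t *\<^sub>R a) - f (u + t *\<^sub>R b) + f u
           - t\<^sup>2 *\<^sub>R Fa b) \<le> e * t\<^sup>2) (at_right (0::real))"
proof -
  \<comment> \<open>The remainders met in \<open>bnd\<close> add up to
    \<open>e / K * (t * (K - 1))\<close>; the extra 1 keeps \<open>K\<close> positive when
    \<open>a\<close> and \<open>b\<close> vanish.\<close>
  define K where "K = 2 * norm a + norm b + 1"
  have K: "K > 0" unfolding K_def by (simp add: add_nonneg_pos)
  interpret Fa: bounded_linear Fa using Fa by (rule has_derivative_bounded_linear)
  obtain d1 where d1: "d1 > 0"
    "\<And>y. norm (y - u) < d1 \<Longrightarrow> norm (f' y a - f' u a - Fa (y - u)) \<le> e / K * norm (y - u)"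
    using Fa e K unfolding has_derivative_at_alt by (meson divide_pos_pos)
  obtain d2 where d2: "d2 > 0" "ball u d2 \<subseteq> S"
    using S openE by blast
  define d where "d = min d1 d2 / K"
  have d: "d > 0" using d1 d2 K by (simp add: d_def)
  have "norm (f (u + t *\<^sub>R a + t *\<^sub>R b) - f (u + t *\<^sub>R a) - f (u + t *\<^sub>R b) + f u - t\<^sup>2 *\<^sub>R Fa b) \<le> e * t\<^sup>2"
    if t: "0 < t" "t < d" for t
  proof -
    have small: "norm (s *\<^sub>R a + r *\<^sub>R b) < min d1 d2" "norm (s *\<^sub>R a + r *\<^sub>R b) \<le> t * norm a + r * norm b"
      if "0 \<le> s" "s \<le> t" "0 \<le> r" "r \<le> t" for s r
    proof -
      have "norm (s *\<^sub>R a + r *\<^sub>R b) \<le> s * norm a + r * norm b"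
        using that by (metis abs_of_nonneg norm_scaleR norm_triangle_ineq)
      also have "\<dots> \<le> t * norm a + r * norm b"
        using that by (simp add: mult_right_mono)
      finally show le: "norm (s *\<^sub>R a + r *\<^sub>R b) \<le> t * norm a + r * norm b" .
      also have "\<dots> \<le> t * norm a + t * norm b"
        using that by (simp add: mult_right_mono)
      also have "\<dots> \<le> t * K"
        using t by (simp add: K_def algebra_simps)
      also have "\<dots> < min d1 d2"
        using t K by (simp add: d_def field_simps)
      finally show "norm (s *\<^sub>R a + r *\<^sub>R b) < min d1 d2" .
    qed
    \<comment> \<open>The second difference minus \<open>t\<^sup>2 Fa b\<close> is \<open>g t - g 0\<close>; mean value inequality for \<open>g\<close>.\<close>
    define g where "g = (\<lambda>s. f (u + s *\<^sub>R a + t *\<^sub>R b) - f (u + s *\<^sub>R a) - (s * t) *\<^sub>R Fa b)"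
    define g' where "g' = (\<lambda>s. f' (u + s *\<^sub>R a + t *\<^sub>R b) a - f' (u + s *\<^sub>R a) a - t *\<^sub>R Fa b)"
    have in_S: "u + s *\<^sub>R a + r *\<^sub>R b \<in> S" if "0 \<le> s" "s \<le> t" "0 \<le> r" "r \<le> t" for s r
    proof -
      have "dist u (u + s *\<^sub>R a + r *\<^sub>R b) < d2"
        using small(1)[OF that] by (metis add.assoc add_diff_cancel_left' dist_commute dist_norm min_less_iff_conj)
      then show ?thesis using d2 by auto
    qed
    have der: "((\<lambda>s. f (u + s *\<^sub>R a + r *\<^sub>R b)) has_vector_derivative f' (u + s *\<^sub>R a + r *\<^sub>R b) a) (at s)"
      if "0 \<le> s" "s \<le> t" "0 \<le> r" "r \<le> t" for s r
    proof -
      interpret D: bounded_linear "f' (u + s *\<^sub>R a + r *\<^sub>R b)"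
        using f'[OF in_S[OF that]] by (rule has_derivative_bounded_linear)
      have "((\<lambda>s. u + s *\<^sub>R a + r *\<^sub>R b) has_derivative (\<lambda>h. h *\<^sub>R a)) (at s)"
        by (auto intro!: derivative_eq_intros)
      from has_derivative_compose[OF this f'[OF in_S[OF that]]]
      show ?thesis by (simp add: has_vector_derivative_def D.scaleR)
    qed
    have g_der: "(g has_vector_derivative g' s) (at s)" if "0 \<le> s" "s \<le> t" for s
      unfolding g_def g'_def
      using der[of s t] der[of s 0] that t
      by (auto intro!: derivative_eq_intros)
    have bnd: "norm (g' s) \<le> e * t" if s: "0 \<le> s" "s \<le> t" for s
    proof -
      \<comment> \<open>\<open>?R r\<close> is the error of the first-order expansion of
        \<open>f' x a\<close> at \<open>u\<close>. In \<open>?R t - ?R 0\<close> the terms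
        \<open>f' u a\<close> and \<open>Fa (s *\<^sub>R a)\<close> cancel, which leaves
        \<open>g' s\<close>.\<close>
      let ?R = "\<lambda>r. f' (u + s *\<^sub>R a + r *\<^sub>R b) a - f' u a - Fa (s *\<^sub>R a + r *\<^sub>R b)"
      have R: "norm (?R r) \<le> e / K * (t * norm a + r * norm b)" if "0 \<le> r" "r \<le> t" for r
      proof -
        have "norm (?R r) \<le> e / K * norm (s *\<^sub>R a + r *\<^sub>R b)"
          using d1(2)[of "u + s *\<^sub>R a + r *\<^sub>R b"] small(1)[OF s that] by (simp add: add.assoc)
        also have "\<dots> \<le> e / K * (t * norm a + r * norm b)"
          using small(2)[OF s that] e K by (intro mult_left_mono) auto
        finally show ?thesis .
      qed
      have "g' s = ?R t - ?R 0"
        by (simp add: g'_def Fa.add Fa.scaleR)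
      then have "norm (g' s) \<le> norm (?R t) + norm (?R 0)"
        by (metis norm_triangle_ineq4)
      also have "\<dots> \<le> e / K * (t * norm a + t * norm b) + e / K * (t * norm a + 0 * norm b)"
        using R[of t] R[of 0] t by simp
      also have "\<dots> = e / K * (t * (K - 1))"
        by (simp add: K_def algebra_simps add_divide_distrib)
      also have "\<dots> \<le> e / K * (t * K)"
        using e K t by (intro mult_left_mono) auto
      also have "\<dots> = e * t" using K by simp
      finally show ?thesis .
    qed
    have "norm (g t - g 0) \<le> (e * t) * t - (e * t) * 0"
    proof (rule differentiable_bound_general[where f' = g' and \<phi>' = "\<lambda>_. e * t"])
      show "continuous_on {0..t} g"
        using g_der by (intro continuous_at_imp_continuous_on ballI) (meson atLeastAtMost_iff has_vector_derivative_continuous)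
    qed (use t g_der bnd in \<open>auto intro!: continuous_intros derivative_eq_intros\<close>)
    moreover have "g t - g 0 = f (u + t *\<^sub>R a + t *\<^sub>R b) - f (u + t *\<^sub>R a) - f (u + t *\<^sub>R b) + f u - t\<^sup>2 *\<^sub>R Fa b"
      by (simp add: g_def power2_eq_square)
    ultimately show ?thesis by (simp add: power2_eq_square mult.assoc)
  qed
  then show ?thesis
    unfolding eventually_at_right_field using d by blast
qed

text \<open>The second difference is invariant under swapping \<open>a\<close> and \<open>b\<close>,
  so it approximates both \<open>t\<^sup>2 *\<^sub>R Fa b\<close> and
  \<open>t\<^sup>2 *\<^sub>R Fb a\<close>; dividing by \<open>t\<^sup>2\<close> leaves an
  arbitrarily small distance. The case \<open>f = M\<close> is the compatibility condition.\<close>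

lemma second_derivative_symmetric:
  fixes f :: "'a::real_normed_vector \<Rightarrow> 'b::real_normed_vector"
  assumes S: "open S" "u \<in> S"
    and f': "\<And>x. x \<in> S \<Longrightarrow> (f has_derivative f' x) (at x)"
    and Fa: "((\<lambda>x. f' x a) has_derivative Fa) (at u)"
    and Fb: "((\<lambda>x. f' x b) has_derivative Fb) (at u)"
  shows "Fa b = Fb a"
proof -
  have "norm (Fa b - Fb a) \<le> e" if "e > 0" for e
  proof -
    have approx: "eventually (\<lambda>t. norm (f (u + t *\<^sub>R v + t *\<^sub>R w) - f (u + t *\<^sub>R v) - f (u + t *\<^sub>R w) + f u
           - t\<^sup>2 *\<^sub>R F w) \<le> e / 2 * t\<^sup>2) (at_right (0::real))"
      if "((\<lambda>x. f' x v) has_derivative F) (at u)" for v w F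
      using f' that \<open>e > 0\<close> by (intro second_difference_approx[OF S]) auto
    have "eventually (\<lambda>t. norm (Fa b - Fb a) \<le> e) (at_right (0::real))"
      using approx[OF Fa, of b] approx[OF Fb, of a] eventually_at_right_less[of 0]
    proof eventually_elim
      case (elim t)
      let ?\<Delta> = "f (u + t *\<^sub>R a + t *\<^sub>R b) - f (u + t *\<^sub>R a) - f (u + t *\<^sub>R b) + f u"
      have "norm (?\<Delta> - t\<^sup>2 *\<^sub>R Fb a) \<le> e / 2 * t\<^sup>2"
        using elim(2) by (simp add: algebra_simps)
      then have "norm ((?\<Delta> - t\<^sup>2 *\<^sub>R Fb a) - (?\<Delta> - t\<^sup>2 *\<^sub>R Fa b)) \<le> e / 2 * t\<^sup>2 + e / 2 * t\<^sup>2"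
        using elim(1) by (intro order_trans[OF norm_triangle_ineq4 add_mono])
      moreover have "(?\<Delta> - t\<^sup>2 *\<^sub>R Fb a) - (?\<Delta> - t\<^sup>2 *\<^sub>R Fa b) = t\<^sup>2 *\<^sub>R (Fa b - Fb a)"
        by (simp add: scaleR_diff_right)
      ultimately have "norm (t\<^sup>2 *\<^sub>R (Fa b - Fb a)) \<le> e / 2 * t\<^sup>2 + e / 2 * t\<^sup>2"
        by (simp only:)
      then have "t\<^sup>2 * norm (Fa b - Fb a) \<le> t\<^sup>2 * e"
        by (simp add: mult.commute)
      then show ?case using elim(3) by simp
    qed
    \<comment> \<open>The bound does not involve \<open>t\<close>, and \<open>at_right 0\<close> is
      a nontrivial filter.\<close>
    then show ?thesis by simp
  qed
  then have "norm (Fa b - Fb a) \<le> 0" by (rule field_le_epsilon[of _ 0, simplified])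
  then show ?thesis by simp
qed

subsection \<open>Multilinear forms on a subspace\<close>

text \<open>This is the linearity clause of \<open>symmetric_form\<close>, isolated because it is
  inherited, with \<open>p\<close> lowered by one, when the first argument is fixed.\<close>

definition multilinear_on :: "nat \<Rightarrow> 'v::real_vector set \<Rightarrow> ('v list \<Rightarrow> 'k::real_vector) \<Rightarrow> bool" where
  "multilinear_on p V F \<longleftrightarrow>
     (\<forall>Xs i X Y a b. length Xs = p \<and> set Xs \<subseteq> V \<and> i < p \<and> X \<in> V \<and> Y \<in> V \<longrightarrow>
        F (Xs[i := a *\<^sub>R X + b *\<^sub>R Y]) = a *\<^sub>R F (Xs[i := X]) + b *\<^sub>R F (Xs[i := Y]))"

lemma multilinear_onD:
  "multilinear_on p V F \<Longrightarrow> length Xs = p \<Longrightarrow> set Xs \<subseteq> V \<Longrightarrow> i < p \<Longrightarrow> X \<in> V \<Longrightarrow> Y \<in> V \<Longrightarrow>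
     F (Xs[i := a *\<^sub>R X + b *\<^sub>R Y]) = a *\<^sub>R F (Xs[i := X]) + b *\<^sub>R F (Xs[i := Y])"
  unfolding multilinear_on_def by blast

lemma multilinear_on_Cons:
  assumes "multilinear_on (Suc p) V F" "v \<in> V"
  shows "multilinear_on p V (\<lambda>Xs. F (v # Xs))"
  unfolding multilinear_on_def
proof (intro allI impI)
  fix Xs i X Y a b
  assume "length Xs = p \<and> set Xs \<subseteq> V \<and> i < p \<and> X \<in> V \<and> Y \<in> V"
  then show "F (v # Xs[i := a *\<^sub>R X + b *\<^sub>R Y]) = a *\<^sub>R F (v # Xs[i := X]) + b *\<^sub>R F (v # Xs[i := Y])"
    using multilinear_onD[OF assms(1), of "v # Xs" "Suc i" X Y a b] assms(2) by simp
qed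

lemma multilinear_on_sum:
  assumes F: "multilinear_on p V F" and V: "subspace V"
    and Xs: "length Xs = p" "set Xs \<subseteq> V" "j < p"
    and I: "finite I" "\<And>i. i \<in> I \<Longrightarrow> v i \<in> V"
  shows "F (Xs[j := (\<Sum>i\<in>I. c i *\<^sub>R v i)]) = (\<Sum>i\<in>I. c i *\<^sub>R F (Xs[j := v i]))"
  using I
proof (induction I rule: finite_induct)
  case empty
  \<comment> \<open>With both scalars 0, linearity says that a zero argument gives the value
    0.\<close>
  show ?case
    using multilinear_onD[OF F Xs subspace_0[OF V] subspace_0[OF V], of 0 0] by simp
next
  case (insert i I)
  have "(\<Sum>i\<in>I. c i *\<^sub>R v i) \<in> V"
    using insert.prems V by (auto intro!: subspace_sum subspace_scale)
  then show ?case
    using multilinear_onD[OF F Xs, of "v i" "\<Sum>i\<in>I. c i *\<^sub>R v i" "c i" 1] insert by simp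
qed

text \<open>For an orthonormal basis the coordinates \<open>x \<bullet> e\<close> are bounded linear
  on the whole space, so they can be differentiated even though a form is linear only on
  \<open>V\<close>.\<close>

lemma subspace_coordinates:
  fixes V :: "'a::euclidean_space set"
  assumes "subspace V"
  obtains E where "finite E" "E \<subseteq> V" "\<And>x. x \<in> V \<Longrightarrow> (\<Sum>e\<in>E. (x \<bullet> e) *\<^sub>R e) = x"
proof -
  obtain E where "E \<subseteq> V" "pairwise orthogonal E" "\<And>x. x \<in> E \<Longrightarrow> norm x = 1" "independent E" "span E = V"
    using orthonormal_basis_subspace[OF assms] by metis
  then show thesis
    using that[of E] orthonormal_basis_expand[of E] independent_imp_finite[of E] by auto
qed

text \<open>Near \<open>u\<close> the function equals its expansion in a basis of \<open>V\<close>,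
  so its derivative has such an expansion too. This permits inserting derivatives into a form that
  is linear only on \<open>V\<close>.\<close>

lemma has_derivative_in_subspace:
  fixes X :: "'a::real_normed_vector \<Rightarrow> 'b::euclidean_space"
  assumes S: "open S" "u \<in> S" and V: "subspace V"
    and X: "\<And>x. x \<in> S \<Longrightarrow> X x \<in> V" and X': "(X has_derivative X') (at u)"
  shows "X' h \<in> V"
proof -
  obtain E where E: "finite E" "E \<subseteq> V" "\<And>x. x \<in> V \<Longrightarrow> (\<Sum>e\<in>E. (x \<bullet> e) *\<^sub>R e) = x"
    using subspace_coordinates[OF V] by metis
  have "((\<lambda>x. \<Sum>e\<in>E. (X x \<bullet> e) *\<^sub>R e) has_derivative (\<lambda>h. \<Sum>e\<in>E. (X' h \<bullet> e) *\<^sub>R e)) (at u)"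
    using X' by (auto intro!: derivative_eq_intros)
  then have "(X has_derivative (\<lambda>h. \<Sum>e\<in>E. (X' h \<bullet> e) *\<^sub>R e)) (at u)"
    by (rule has_derivative_transform_within_open[OF _ S]) (simp add: E X)
  then have "X' h = (\<Sum>e\<in>E. (X' h \<bullet> e) *\<^sub>R e)"
    using has_derivative_unique[OF X'] by metis
  also have "\<dots> \<in> V"
    using E(2) V by (auto intro!: subspace_sum subspace_scale)
  finally show ?thesis .
qed

text \<open>The Leibniz rule, by induction on the arguments: expanding the head in a basis gives a
  finite sum of scalar coordinates times forms with a constant head, which the induction hypothesis
  differentiates. Finite dimension thus replaces a continuity assumption on
  \<open>F\<close>.\<close>

lemma has_derivative_multilinear_on:
  fixes Xs :: "('a::real_normed_vector \<Rightarrow> 'b::euclidean_space) list"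
    and F :: "'b list \<Rightarrow> 'c::real_normed_vector"
  assumes S: "open S" "u \<in> S" and V: "subspace V"
    and F: "multilinear_on p V F" and len: "length Xs = p"
    and X: "\<And>X x. X \<in> set Xs \<Longrightarrow> x \<in> S \<Longrightarrow> X x \<in> V"
    and X': "\<And>i. i < p \<Longrightarrow> ((Xs ! i) has_derivative Xs' i) (at u)"
  shows "((\<lambda>x. F (map (\<lambda>X. X x) Xs)) has_derivative
           (\<lambda>h. \<Sum>i<p. F ((map (\<lambda>X. X u) Xs)[i := Xs' i h]))) (at u)"
  using F len X X'
proof (induction Xs arbitrary: p F Xs')
  case Nil
  then show ?case by simp
next
  case (Cons Y Ys)
  then obtain q where p: "p = Suc q" and q: "length Ys = q" by auto
  note F = Cons.prems(1)[unfolded p]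
  let ?Ys = "\<lambda>x. map (\<lambda>X. X x) Ys"
  have Y: "Y x \<in> V" and Ys: "set (?Ys x) \<subseteq> V" if "x \<in> S" for x
    using Cons.prems(3) that by auto
  have Y': "(Y has_derivative Xs' 0) (at u)"
    using Cons.prems(4)[of 0] p by simp
  have Ys': "((Ys ! i) has_derivative Xs' (Suc i)) (at u)" if "i < q" for i
    using Cons.prems(4)[of "Suc i"] p that by simp
  have Ys'_V: "Xs' (Suc i) h \<in> V" if "i < q" for i h
    using Cons.prems(3) q that by (intro has_derivative_in_subspace[OF S V _ Ys'[OF that]]) auto
  \<comment> \<open>\<open>F\<close> is only multilinear on \<open>V\<close>, so the head is expanded in coordinates of \<open>V\<close>.\<close>
  obtain E where E: "finite E" "E \<subseteq> V" "\<And>x. x \<in> V \<Longrightarrow> (\<Sum>e\<in>E. (x \<bullet> e) *\<^sub>R e) = x"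
    using subspace_coordinates[OF V] by metis
  have expand: "F (y # Zs) = (\<Sum>e\<in>E. (y \<bullet> e) *\<^sub>R F (e # Zs))"
    if "y \<in> V" "length Zs = q" "set Zs \<subseteq> V" for y Zs
    \<comment> \<open>The \<open>0\<close> in \<open>0 # Zs\<close> is a placeholder that the update
      at slot 0 overwrites.\<close>
    using multilinear_on_sum[OF F V, of "0 # Zs" 0 E "\<lambda>e. e" "\<lambda>e. y \<bullet> e"] that E subspace_0[OF V]
    by auto
  have IH: "((\<lambda>x. F (e # ?Ys x)) has_derivative
      (\<lambda>h. \<Sum>i<q. F (e # (?Ys u)[i := Xs' (Suc i) h]))) (at u)" if "e \<in> E" for e
    using Cons.IH[of q "\<lambda>Zs. F (e # Zs)" "\<lambda>i. Xs' (Suc i)"] multilinear_on_Cons[OF F] that E(2)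
      q Ys' Cons.prems(3) by auto
  have "((\<lambda>x. \<Sum>e\<in>E. (Y x \<bullet> e) *\<^sub>R F (e # ?Ys x)) has_derivative
      (\<lambda>h. \<Sum>e\<in>E. (Y u \<bullet> e) *\<^sub>R (\<Sum>i<q. F (e # (?Ys u)[i := Xs' (Suc i) h]))
                  + (Xs' 0 h \<bullet> e) *\<^sub>R F (e # ?Ys u))) (at u)"
    by (intro has_derivative_sum has_derivative_scaleR has_derivative_inner_left Y' IH)
  moreover have "(\<Sum>e\<in>E. (Y u \<bullet> e) *\<^sub>R (\<Sum>i<q. F (e # (?Ys u)[i := Xs' (Suc i) h]))
                  + (Xs' 0 h \<bullet> e) *\<^sub>R F (e # ?Ys u))
      = (\<Sum>i<p. F ((map (\<lambda>X. X u) (Y # Ys))[i := Xs' i h]))" for h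
  proof -
    \<comment> \<open>Folding the head back requires the tail to stay in \<open>V\<close> after one
      entry is replaced by its derivative, which \<open>Ys'_V\<close> ensures.\<close>
    have "(\<Sum>e\<in>E. (Y u \<bullet> e) *\<^sub>R (\<Sum>i<q. F (e # (?Ys u)[i := Xs' (Suc i) h])))
        = (\<Sum>i<q. F (Y u # (?Ys u)[i := Xs' (Suc i) h]))"
    proof -
      have "F (Y u # (?Ys u)[i := Xs' (Suc i) h])
          = (\<Sum>e\<in>E. (Y u \<bullet> e) *\<^sub>R F (e # (?Ys u)[i := Xs' (Suc i) h]))" if "i < q" for i
        using Ys[OF S(2)] Ys'_V[OF that] q
        by (intro expand Y S set_update_subsetI) auto
      then show ?thesis
        by (simp add: scaleR_sum_right) (rule sum.swap)
    qed
    moreover have "(\<Sum>e\<in>E. (Xs' 0 h \<bullet> e) *\<^sub>R F (e # ?Ys u)) = F (Xs' 0 h # ?Ys u)"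
      using has_derivative_in_subspace[OF S V Y Y'] Ys[OF S(2)] q by (intro expand[symmetric]) auto
    ultimately show ?thesis
      unfolding p sum.lessThan_Suc_shift by (simp add: sum.distrib)
  qed
  ultimately have "((\<lambda>x. \<Sum>e\<in>E. (Y x \<bullet> e) *\<^sub>R F (e # ?Ys x)) has_derivative
      (\<lambda>h. \<Sum>i<p. F ((map (\<lambda>X. X u) (Y # Ys))[i := Xs' i h]))) (at u)"
    by (simp only:)
  then show ?case
    by (rule has_derivative_transform_within_open[OF _ S]) (use expand Y Ys q in auto)
qed

subsection \<open>The commutator\<close>

lemma bounded_bilinear_matrix_mult:
  "bounded_bilinear ((**) :: 'k::{real_normed_field,euclidean_space}^'m::finite^'m \<Rightarrow> _)"
  unfolding bilinear_conv_bounded_bilinear[symmetric] bilinear_def linear_iff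
  by (auto simp: vec_eq_iff matrix_matrix_mult_def scaleR_sum_right sum.distrib algebra_simps)

text \<open>Bilinear maps in finite dimension are bounded; this makes the product rule
  \<open>commutator.FDERIV\<close> available.\<close>

lemma bounded_bilinear_commutator:
  "bounded_bilinear (commutator :: 'k::{real_normed_field,euclidean_space}^'m::finite^'m \<Rightarrow> _)"
proof -
  interpret m: bounded_bilinear "(**) :: 'k^'m^'m \<Rightarrow> _" by (rule bounded_bilinear_matrix_mult)
  show ?thesis
    unfolding bilinear_conv_bounded_bilinear[symmetric] bilinear_def linear_iff commutator_def
    by (auto simp: m.add_left m.add_right m.scaleR_left m.scaleR_right scaleR_diff_right)
qed

interpretation commutator: bounded_bilinear
  "commutator :: 'k::{real_normed_field,euclidean_space}^'m::finite^'m \<Rightarrow> _"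
  by (rule bounded_bilinear_commutator)

lemma commutator_swap: "commutator X Y = - commutator Y X"
  by (simp add: commutator_def)

text \<open>Stated as the derivation property of ad X, which matches the nested brackets produced by
  differentiating \<open>M\<close>.\<close>

lemma commutator_jacobi:
  fixes X Y Z :: "'k::{real_normed_field,euclidean_space}^'m::finite^'m"
  shows "commutator X (commutator Y Z) = commutator (commutator X Y) Z + commutator Y (commutator X Z)"
proof -
  interpret m: bounded_bilinear "(**) :: 'k^'m^'m \<Rightarrow> _" by (rule bounded_bilinear_matrix_mult)
  show ?thesis
    by (simp add: commutator_def m.diff_left m.diff_right matrix_mul_assoc)
qed

subsection \<open>Coefficients of the Lax identity\<close>

lemma smooth_on_imp_differentiable: "smooth_on \<Omega> P \<Longrightarrow> u \<in> \<Omega> \<Longrightarrow> P differentiable (at u)"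
  unfolding smooth_on_def using Ck_on.simps(2) by blast

lemma has_derivative_frechet: "P differentiable (at u) \<Longrightarrow> (P has_derivative frechet_derivative P (at u)) (at u)"
  by (simp add: frechet_derivative_works)

lemma frechet_derivative_zero:
  "P differentiable (at u) \<Longrightarrow> frechet_derivative P (at u) 0 = 0"
  by (simp add: linear_0 linear_frechet_derivative)

lemma partial_deriv_eq: "(P has_derivative P') (at u) \<Longrightarrow> partial_deriv \<alpha> P u = P' (axis \<alpha> 1)"
  by (simp add: partial_deriv_def frechet_derivative_at[symmetric])

text \<open>Both Lax matrices have this shape, with \<open>c\<close> equal to \<open>lam\<close> or
  \<open>1 / lam\<close>; the two conclusions differ in whether \<open>ux\<close> or
  \<open>uy\<close> is contracted with \<open>A\<close>.\<close>

lemma has_derivative_lax: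
  fixes A :: "'n::finite \<Rightarrow> real^'n \<Rightarrow> 'b::real_normed_vector"
  assumes "\<And>\<alpha>. A \<alpha> differentiable (at u)" "M differentiable (at u)"
  shows "((\<lambda>(u, ux, uy). (\<Sum>\<alpha>\<in>UNIV. (ux $ \<alpha>) *\<^sub>R A \<alpha> u) + c *\<^sub>R M u) has_derivative
    (\<lambda>(v, vx, vy). (\<Sum>\<alpha>\<in>UNIV. (ux $ \<alpha>) *\<^sub>R frechet_derivative (A \<alpha>) (at u) v + (vx $ \<alpha>) *\<^sub>R A \<alpha> u)
        + c *\<^sub>R frechet_derivative M (at u) v)) (at (u, ux, uy))"
    (is ?thesis1)
    and "((\<lambda>(u, ux, uy). (\<Sum>\<alpha>\<in>UNIV. (uy $ \<alpha>) *\<^sub>R A \<alpha> u) + c *\<^sub>R M u) has_derivative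
    (\<lambda>(v, vx, vy). (\<Sum>\<alpha>\<in>UNIV. (uy $ \<alpha>) *\<^sub>R frechet_derivative (A \<alpha>) (at u) v + (vy $ \<alpha>) *\<^sub>R A \<alpha> u)
        + c *\<^sub>R frechet_derivative M (at u) v)) (at (u, ux, uy))"
    (is ?thesis2)
proof -
  have fst': "(fst has_derivative fst) (at (u, ux, uy))"
    by (rule has_derivative_fst[OF has_derivative_ident])
  have comp: "((\<lambda>z. P (fst z)) has_derivative (\<lambda>z. frechet_derivative P (at u) (fst z))) (at (u, ux, uy))"
    if "P differentiable (at u)" for P :: "real^'n \<Rightarrow> 'b"
    using has_derivative_compose[OF fst', of P "frechet_derivative P (at u)"] has_derivative_frechet[OF that]
    by simp
  have nthx: "((\<lambda>z. fst (snd z) $ \<alpha>) has_derivative (\<lambda>z. fst (snd z) $ \<alpha>)) (at (u, ux, uy))"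
    and nthy: "((\<lambda>z. snd (snd z) $ \<alpha>) has_derivative (\<lambda>z. snd (snd z) $ \<alpha>)) (at (u, ux, uy))" for \<alpha>
    by (auto intro!: bounded_linear.has_derivative[OF bounded_linear_vec_nth] derivative_eq_intros)
  show ?thesis1 ?thesis2
    unfolding case_prod_beta
    using nthx nthy comp[OF assms(1)] comp[OF assms(2)]
    by (auto intro!: derivative_eq_intros)
qed

text \<open>\<open>lax_A\<close> depends on \<open>ux\<close>, whose y-derivative is
  \<open>uxy\<close>, and \<open>lax_B\<close> on \<open>uy\<close>, whose x-derivative is
  \<open>uxy\<close> as well; hence \<open>uxx\<close> and \<open>uyy\<close> drop out.\<close>

lemma total_deriv_lax:
  fixes A :: "'n::finite \<Rightarrow> real^'n \<Rightarrow> 'b::real_normed_vector"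
  assumes "\<And>\<alpha>. A \<alpha> differentiable (at u)" "M differentiable (at u)"
  shows total_deriv_y_lax_A: "total_deriv_y (lax_A A M lam) (u, ux, uy, uxx, uxy, uyy)
      = (\<Sum>\<alpha>\<in>UNIV. (ux $ \<alpha>) *\<^sub>R frechet_derivative (A \<alpha>) (at u) uy + (uxy $ \<alpha>) *\<^sub>R A \<alpha> u)
        + lam *\<^sub>R frechet_derivative M (at u) uy"
    and total_deriv_x_lax_B: "total_deriv_x (lax_B A M lam) (u, ux, uy, uxx, uxy, uyy)
      = (\<Sum>\<alpha>\<in>UNIV. (uy $ \<alpha>) *\<^sub>R frechet_derivative (A \<alpha>) (at u) ux + (uxy $ \<alpha>) *\<^sub>R A \<alpha> u)
        + (1 / lam) *\<^sub>R frechet_derivative M (at u) ux"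
  unfolding total_deriv_y_def total_deriv_x_def lax_A_def lax_B_def
  by (simp_all add: frechet_derivative_at[OF has_derivative_lax(1)[OF assms], symmetric]
      frechet_derivative_at[OF has_derivative_lax(2)[OF assms], symmetric])

lemma sum_axis_scaleR: "(\<Sum>\<alpha>\<in>UNIV. (axis \<beta> 1 $ \<alpha>) *\<^sub>R X \<alpha>) = (X \<beta> :: 'b::real_vector)"
proof -
  have "(\<Sum>\<alpha>\<in>UNIV. (axis \<beta> 1 $ \<alpha>) *\<^sub>R X \<alpha>) = (\<Sum>\<alpha>\<in>UNIV. if \<alpha> = \<beta> then X \<alpha> else 0)"
    by (intro sum.cong) (auto simp: axis_def)
  then show ?thesis by simp
qed

context
  fixes \<Omega> :: "(real^'n::finite) set"
    and G :: "'n \<Rightarrow> 'n \<Rightarrow> 'n \<Rightarrow> real^'n \<Rightarrow> real"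
    and Q :: "'n \<Rightarrow> real^'n \<Rightarrow> real"
    and \<gg> :: "('k::{real_normed_field,euclidean_space}^'m::finite^'m) set"
    and A B :: "'n \<Rightarrow> real^'n \<Rightarrow> 'k^'m^'m"
    and M N :: "real^'n \<Rightarrow> 'k^'m^'m"
  assumes lax: "lax_representation \<Omega> G Q \<gg> A B M N"
begin

lemma lax_differentiable:
  assumes "u \<in> \<Omega>"
  shows "A \<alpha> differentiable (at u)" "B \<alpha> differentiable (at u)" "M differentiable (at u)" "N differentiable (at u)"
  using lax assms unfolding lax_representation_def by (auto intro: smooth_on_imp_differentiable)

lemma lax_identity:
  assumes u: "u \<in> \<Omega>" and "lam \<noteq> 0"
  shows "(\<Sum>\<alpha>\<in>UNIV. (ux $ \<alpha>) *\<^sub>R frechet_derivative (A \<alpha>) (at u) uy) + lam *\<^sub>R frechet_derivative M (at u) uy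
    - ((\<Sum>\<alpha>\<in>UNIV. (uy $ \<alpha>) *\<^sub>R frechet_derivative (B \<alpha>) (at u) ux) + (1 / lam) *\<^sub>R frechet_derivative N (at u) ux)
    + commutator ((\<Sum>\<alpha>\<in>UNIV. (ux $ \<alpha>) *\<^sub>R A \<alpha> u) + lam *\<^sub>R M u)
        ((\<Sum>\<alpha>\<in>UNIV. (uy $ \<alpha>) *\<^sub>R B \<alpha> u) + (1 / lam) *\<^sub>R N u)
    = (\<Sum>\<alpha>\<in>UNIV. ((\<Sum>\<beta>\<in>UNIV. \<Sum>\<gamma>\<in>UNIV. G \<alpha> \<beta> \<gamma> u * ux $ \<beta> * uy $ \<gamma>) + Q \<alpha> u)
          *\<^sub>R characteristic_element A B \<alpha> u)"
proof -
  \<comment> \<open>Zero second-order coordinates lose nothing: on both sides \<open>uxy\<close>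
    enters only through its contraction with \<open>A \<alpha> u - B \<alpha> u\<close>.\<close>
  have "total_deriv_y (lax_A A M lam) (u, ux, uy, 0, 0, 0)
        - total_deriv_x (lax_B B N lam) (u, ux, uy, 0, 0, 0)
        + commutator (lax_A A M lam (u, ux, uy)) (lax_B B N lam (u, ux, uy))
        = (\<Sum>\<alpha>\<in>UNIV. chiral_system G Q \<alpha> (u, ux, uy, 0, 0, 0)
                      *\<^sub>R characteristic_element A B \<alpha> u)"
    using lax assms unfolding lax_representation_def by blast
  then show ?thesis
    unfolding total_deriv_y_lax_A[OF lax_differentiable(1,3)[OF u]]
      total_deriv_x_lax_B[OF lax_differentiable(2,4)[OF u]]
    by (simp add: lax_A_def lax_B_def chiral_system_def)
qed

lemma lax_commutator_MN:
  assumes "u \<in> \<Omega>"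
  shows "commutator (M u) (N u) = (\<Sum>\<alpha>\<in>UNIV. Q \<alpha> u *\<^sub>R characteristic_element A B \<alpha> u)"
  using lax_identity[OF assms, of 1 0 0]
  by (simp add: frechet_derivative_zero lax_differentiable[OF assms])

text \<open>Instead of comparing powers of \<open>lam\<close>, take \<open>lam = 1\<close> and U_x =
  0: this removes \<open>G\<close>, \<open>A\<close> and the derivatives of \<open>B\<close> and
  \<open>N\<close>, while [M, N] cancels the \<open>Q\<close> term.\<close>

lemma partial_deriv_M:
  assumes "u \<in> \<Omega>"
  shows "partial_deriv \<beta> M u = commutator (B \<beta> u) (M u)"
  using lax_identity[OF assms, of 1 0 "axis \<beta> 1"]
  by (simp add: frechet_derivative_zero lax_differentiable[OF assms] lax_commutator_MN[OF assms]
      sum_axis_scaleR commutator.add_right partial_deriv_def commutator_swap[of "B \<beta> u" "M u"]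
      eq_neg_iff_add_eq_0)

lemma partial_deriv_N:
  assumes "u \<in> \<Omega>"
  shows "partial_deriv \<beta> N u = commutator (A \<beta> u) (N u)"
  using lax_identity[OF assms, of 1 "axis \<beta> 1" 0]
  by (simp add: frechet_derivative_zero lax_differentiable[OF assms] lax_commutator_MN[OF assms]
      sum_axis_scaleR commutator.add_left partial_deriv_def)

text \<open>Again \<open>lam = 1\<close>, now with both first derivatives equal to unit vectors. The
  extra terms cancel in pairs by the equations for the derivatives of \<open>M\<close> and
  \<open>N\<close> and by \<open>lax_commutator_MN\<close>.\<close>

lemma lax_curvature:
  assumes "u \<in> \<Omega>"
  shows "partial_deriv \<gamma> (A \<beta>) u - partial_deriv \<beta> (B \<gamma>) u + commutator (A \<beta> u) (B \<gamma> u)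
    = (\<Sum>\<alpha>\<in>UNIV. G \<alpha> \<beta> \<gamma> u *\<^sub>R characteristic_element A B \<alpha> u)"
proof -
  have "(\<Sum>\<beta>'\<in>UNIV. \<Sum>\<gamma>'\<in>UNIV. G \<alpha> \<beta>' \<gamma>' u * axis \<beta> 1 $ \<beta>' * axis \<gamma> 1 $ \<gamma>') = G \<alpha> \<beta> \<gamma> u" for \<alpha>
    using sum_axis_scaleR[of \<beta> "\<lambda>\<beta>'. \<Sum>\<gamma>'\<in>UNIV. axis \<gamma> 1 $ \<gamma>' * G \<alpha> \<beta>' \<gamma>' u"]
      sum_axis_scaleR[of \<gamma> "\<lambda>\<gamma>'. G \<alpha> \<beta> \<gamma>' u"]
    by (simp add: sum_distrib_left ac_simps)
  with lax_identity[OF assms, of 1 "axis \<beta> 1" "axis \<gamma> 1"]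
  have "partial_deriv \<gamma> (A \<beta>) u + partial_deriv \<gamma> M u - (partial_deriv \<beta> (B \<gamma>) u + partial_deriv \<beta> N u)
      + commutator (A \<beta> u + M u) (B \<gamma> u + N u)
      = (\<Sum>\<alpha>\<in>UNIV. G \<alpha> \<beta> \<gamma> u *\<^sub>R characteristic_element A B \<alpha> u) + commutator (M u) (N u)"
    by (simp add: sum_axis_scaleR lax_commutator_MN[OF assms] scaleR_add_left sum.distrib
        flip: partial_deriv_def)
  then show ?thesis
    by (simp add: partial_deriv_M[OF assms] partial_deriv_N[OF assms] commutator.add_left commutator.add_right
        commutator_swap[of "B \<gamma> u" "M u"] algebra_simps)
qed

section \<open>Compatibility condition and covariant derivative of [S, M]\<close>

text \<open>Equality of the mixed second derivatives of \<open>M\<close>. By Jacobi it says that the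
  curvature \<open>B\<^sub>\<alpha>\<^sub>,\<^sub>\<gamma> - B\<^sub>\<gamma>\<^sub>,\<^sub>\<alpha>
  + [B\<^sub>\<alpha>, B\<^sub>\<gamma>]\<close> commutes with \<open>M\<close>.\<close>

lemma partial_deriv_B_commutator_M:
  assumes "open \<Omega>" "u \<in> \<Omega>"
  shows "commutator (partial_deriv \<gamma> (B \<alpha>) u) (M u) + commutator (B \<alpha> u) (commutator (B \<gamma> u) (M u))
    = commutator (partial_deriv \<alpha> (B \<gamma>) u) (M u) + commutator (B \<gamma> u) (commutator (B \<alpha> u) (M u))"
proof -
  have "((\<lambda>x. frechet_derivative M (at x) (axis \<beta> 1)) has_derivative
      (\<lambda>h. commutator (B \<beta> u) (frechet_derivative M (at u) h)
           + commutator (frechet_derivative (B \<beta>) (at u) h) (M u))) (at u)" for \<beta>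
  \<comment> \<open>The first-order equation for \<open>M\<close> holds throughout the open set, so
    both of its sides have the same derivative.\<close>
  proof (rule has_derivative_transform_within_open[OF _ assms])
    show "((\<lambda>x. commutator (B \<beta> x) (M x)) has_derivative
      (\<lambda>h. commutator (B \<beta> u) (frechet_derivative M (at u) h)
           + commutator (frechet_derivative (B \<beta>) (at u) h) (M u))) (at u)"
      by (intro commutator.FDERIV has_derivative_frechet lax_differentiable assms)
  qed (simp add: partial_deriv_M flip: partial_deriv_def)
  note second_derivative_symmetric[OF assms has_derivative_frechet[OF lax_differentiable(3)]
      this[of \<alpha>] this[of \<gamma>], simplified]
  then show ?thesis
    by (simp add: partial_deriv_M[OF assms(2)] add.commute flip: partial_deriv_def)
qed

lemma has_derivative_commutator_S_M:
  assumes "u \<in> \<Omega>"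
  shows "((\<lambda>x. commutator (characteristic_element A B \<alpha> x) (M x)) has_derivative
      (\<lambda>h. commutator (A \<alpha> u - B \<alpha> u) (frechet_derivative M (at u) h)
        + commutator (frechet_derivative (A \<alpha>) (at u) h - frechet_derivative (B \<alpha>) (at u) h) (M u))) (at u)"
  unfolding characteristic_element_def
  by (intro commutator.FDERIV has_derivative_diff has_derivative_frechet lax_differentiable[OF assms])

text \<open>Moving the sum to the left turns this into \<open>\<nabla>\<^sub>\<gamma>
  [S\<^sub>\<alpha>, M] = [B\<^sub>\<gamma>, [S\<^sub>\<alpha>, M]]\<close>.\<close>

lemma partial_deriv_commutator_S_M:
  assumes "open \<Omega>" "u \<in> \<Omega>"
  shows "partial_deriv \<gamma> (\<lambda>x. commutator (characteristic_element A B \<alpha> x) (M x)) u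
    = commutator (B \<gamma> u) (commutator (characteristic_element A B \<alpha> u) (M u))
      + (\<Sum>\<delta>\<in>UNIV. G \<delta> \<alpha> \<gamma> u *\<^sub>R commutator (characteristic_element A B \<delta> u) (M u))"
proof -
  from has_derivative_commutator_S_M[OF assms(2), of \<alpha>]
  have lhs: "partial_deriv \<gamma> (\<lambda>x. commutator (characteristic_element A B \<alpha> x) (M x)) u
      = commutator (A \<alpha> u - B \<alpha> u) (commutator (B \<gamma> u) (M u))
        + commutator (partial_deriv \<gamma> (A \<alpha>) u - partial_deriv \<gamma> (B \<alpha>) u) (M u)"
    by (simp add: partial_deriv_eq flip: partial_deriv_M[OF assms(2)]) (simp add: partial_deriv_def)
  have A': "partial_deriv \<gamma> (A \<alpha>) u = (\<Sum>\<delta>\<in>UNIV. G \<delta> \<alpha> \<gamma> u *\<^sub>R characteristic_element A B \<delta> u)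
      + partial_deriv \<alpha> (B \<gamma>) u - commutator (A \<alpha> u) (B \<gamma> u)"
    using lax_curvature[OF assms(2), of \<gamma> \<alpha>] by (simp add: algebra_simps)
  \<comment> \<open>Compatibility trades the derivatives of \<open>B\<close> for double brackets,
    one of which cancels \<open>[B\<^sub>\<alpha>, [B\<^sub>\<gamma>, M]]\<close>; Jacobi absorbs
    \<open>[[A\<^sub>\<alpha>, B\<^sub>\<gamma>], M]\<close>. Only \<open>S\<^sub>\<alpha>\<close>
    is unfolded, so the \<open>G\<close> sum stays in terms of
    \<open>S\<^sub>\<delta>\<close>.\<close>
  show ?thesis
    using partial_deriv_B_commutator_M[OF assms, of \<gamma> \<alpha>] commutator_jacobi[of "A \<alpha> u" "B \<gamma> u" "M u"]
    unfolding lhs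
    unfolding A' characteristic_element_def[of A B \<alpha>]
    by (simp add: commutator.add_left commutator.diff_left commutator.diff_right commutator.sum_left
        commutator.scaleR_left algebra_simps)
qed

end

section \<open>Leibniz rule and ad-invariance for the tensor K\<close>

theorem theorem1:
  fixes \<Omega> :: "(real^'n::finite) set"
    and G :: "'n \<Rightarrow> 'n \<Rightarrow> 'n \<Rightarrow> real^'n \<Rightarrow> real"
    and Q :: "'n \<Rightarrow> real^'n \<Rightarrow> real"
    and \<gg> :: "('k::{real_normed_field,euclidean_space}^'m::finite^'m) set"
    and A B :: "'n \<Rightarrow> real^'n \<Rightarrow> 'k^'m^'m"
    and M N :: "real^'n \<Rightarrow> 'k^'m^'m"
    and f :: "('k^'m^'m) list \<Rightarrow> 'k"
    and p k :: nat
  assumes "open \<Omega>"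
    and "\<And>\<alpha> \<beta> \<gamma>. smooth_on \<Omega> (G \<alpha> \<beta> \<gamma>)"
    and "\<And>\<alpha>. smooth_on \<Omega> (Q \<alpha>)"
    and "matrix_lie_algebra \<gg>"
    and "lax_representation \<Omega> G Q \<gg> A B M N"
    and "symmetric_form p \<gg> f"
    and "ad_invariant p \<gg> f"
    and "1 \<le> k" and "k \<le> p"
  shows "\<forall>u\<in>\<Omega>. \<forall>\<gamma> \<alpha>s. length \<alpha>s = k \<longrightarrow>
    covariant_deriv G \<gamma> (lax_tensor p f (characteristic_element A B) M) \<alpha>s u = 0"
proof (intro ballI allI impI)
  fix u \<gamma> and \<alpha>s :: "'n list"
  assume u: "u \<in> \<Omega>" and len: "length \<alpha>s = k"
  note lax = assms(5)
  let ?S = "characteristic_element A B"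
  \<comment> \<open>\<open>Xs\<close> lists the arguments of \<open>f\<close> as functions of U,
    ready for the Leibniz rule; \<open>L\<close> holds their values at \<open>u\<close>.\<close>
  define C where "C = (\<lambda>\<alpha> x. commutator (?S \<alpha> x) (M x))"
  define Xs where "Xs = map C \<alpha>s @ replicate (p - k) M"
  define L where "L = map (\<lambda>X. X u) Xs"
  have V: "subspace \<gg>" and comm: "\<And>X Y. X \<in> \<gg> \<Longrightarrow> Y \<in> \<gg> \<Longrightarrow> commutator X Y \<in> \<gg>"
    using assms(4) unfolding matrix_lie_algebra_def by auto
  have f: "multilinear_on p \<gg> f"
    using assms(6) unfolding symmetric_form_def multilinear_on_def by blast
  have AB: "A \<alpha> x \<in> \<gg>" "B \<alpha> x \<in> \<gg>" and M: "M x \<in> \<gg>" if "x \<in> \<Omega>" for \<alpha> x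
    using lax that unfolding lax_representation_def by auto
  have C: "C \<alpha> x \<in> \<gg>" if "x \<in> \<Omega>" for \<alpha> x
    unfolding C_def characteristic_element_def using AB M that by (intro comm subspace_diff[OF V])
  \<comment> \<open>The bound \<open>k \<le> p\<close> makes the natural-number subtraction
    \<open>p - k\<close> exact.\<close>
  have Xs: "length Xs = p" "\<And>X x. X \<in> set Xs \<Longrightarrow> x \<in> \<Omega> \<Longrightarrow> X x \<in> \<gg>"
    using len assms(9) C M by (auto simp: Xs_def)
  then have L: "length L = p" "set L \<subseteq> \<gg>"
    using u by (auto simp: L_def)
  have L_nth: "L ! i = (if i < k then C (\<alpha>s ! i) u else M u)" if "i < p" for i
    using that len assms(9) by (auto simp: L_def Xs_def nth_append)
  have C_diff: "C \<alpha> differentiable (at u)" for \<alpha>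
    using has_derivative_commutator_S_M[OF lax u] unfolding C_def by (rule differentiableI)
  have Xs_diff: "(Xs ! i) differentiable (at u)" if "i < p" for i
    using that len C_diff lax_differentiable(3)[OF lax u] assms(9) by (auto simp: Xs_def nth_append)

  have tensor: "lax_tensor p f ?S M \<alpha>s = (\<lambda>x. f (map (\<lambda>X. X x) Xs))"
    using len by (auto simp: lax_tensor_def Xs_def C_def fun_eq_iff intro!: arg_cong[where f = f])
  have tensor_upd: "lax_tensor p f ?S M (\<alpha>s[i := \<delta>]) u = f (L[i := C \<delta> u])" if "i < k" for i \<delta>
    using len that
    by (simp add: lax_tensor_def L_def Xs_def C_def map_update list_update_append1 comp_def)

  have "(lax_tensor p f ?S M \<alpha>s has_derivative
      (\<lambda>h. \<Sum>i<p. f (L[i := frechet_derivative (Xs ! i) (at u) h]))) (at u)"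
    unfolding tensor L_def
    by (intro has_derivative_multilinear_on[OF assms(1) u V f] Xs has_derivative_frechet Xs_diff)
  then have "partial_deriv \<gamma> (lax_tensor p f ?S M \<alpha>s) u = (\<Sum>i<p. f (L[i := partial_deriv \<gamma> (Xs ! i) u]))"
    by (simp add: partial_deriv_eq) (simp add: partial_deriv_def)
  \<comment> \<open>Every slot contributes ad B; only the first \<open>k\<close> slots, which hold
    [S, M], add a connection term.\<close>
  also have "\<dots> = (\<Sum>i<p. f (L[i := commutator (B \<gamma> u) (L ! i)])
      + (if i < k then \<Sum>\<delta>\<in>UNIV. G \<delta> (\<alpha>s ! i) \<gamma> u *\<^sub>R f (L[i := C \<delta> u]) else 0))"
  proof (rule sum.cong[OF refl])
    fix i assume "i \<in> {..<p}"
    then have i: "i < p" by simp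
    show "f (L[i := partial_deriv \<gamma> (Xs ! i) u]) = f (L[i := commutator (B \<gamma> u) (L ! i)])
      + (if i < k then \<Sum>\<delta>\<in>UNIV. G \<delta> (\<alpha>s ! i) \<gamma> u *\<^sub>R f (L[i := C \<delta> u]) else 0)"
    proof (cases "i < k")
      case True
      then have "partial_deriv \<gamma> (Xs ! i) u
          = 1 *\<^sub>R commutator (B \<gamma> u) (L ! i) + 1 *\<^sub>R (\<Sum>\<delta>\<in>UNIV. G \<delta> (\<alpha>s ! i) \<gamma> u *\<^sub>R C \<delta> u)"
        using partial_deriv_commutator_S_M[OF lax assms(1) u, of \<gamma> "\<alpha>s ! i"] L_nth[OF i] len
        by (simp add: Xs_def C_def nth_append)
      moreover have "(\<Sum>\<delta>\<in>UNIV. G \<delta> (\<alpha>s ! i) \<gamma> u *\<^sub>R C \<delta> u) \<in> \<gg>"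
        using V C[OF u] by (intro subspace_sum subspace_scale)
      moreover have "commutator (B \<gamma> u) (L ! i) \<in> \<gg>"
        using AB[OF u] L i by (intro comm) auto
      ultimately have "f (L[i := partial_deriv \<gamma> (Xs ! i) u]) = f (L[i := commutator (B \<gamma> u) (L ! i)])
          + f (L[i := (\<Sum>\<delta>\<in>UNIV. G \<delta> (\<alpha>s ! i) \<gamma> u *\<^sub>R C \<delta> u)])"
        using multilinear_onD[OF f L i, of _ _ 1 1] by simp
      then show ?thesis
        using True multilinear_on_sum[OF f V L i, of UNIV "\<lambda>\<delta>. C \<delta> u"] C[OF u] by simp
    next
      case False
      then show ?thesis
        using partial_deriv_M[OF lax u] L_nth[OF i] len i assms(9) by (simp add: Xs_def nth_append)
    qed
  qed
  \<comment> \<open>Ad-invariance with \<open>Y = B \<gamma> u\<close> removes the bracket terms of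
    all \<open>p\<close> slots together.\<close>
  also have "\<dots> = (\<Sum>i<p. if i < k then \<Sum>\<delta>\<in>UNIV. G \<delta> (\<alpha>s ! i) \<gamma> u *\<^sub>R f (L[i := C \<delta> u]) else 0)"
    using assms(7) AB[OF u] L unfolding ad_invariant_def by (simp add: sum.distrib)
  also have "\<dots> = (\<Sum>i<k. \<Sum>\<delta>\<in>UNIV. G \<delta> (\<alpha>s ! i) \<gamma> u *\<^sub>R f (L[i := C \<delta> u]))"
    using assms(9) by (intro sum.mono_neutral_cong_right) auto
  \<comment> \<open>By \<open>tensor_upd\<close> the remaining sum is exactly the connection
    correction that \<open>covariant_deriv\<close> subtracts.\<close>
  finally show "covariant_deriv G \<gamma> (lax_tensor p f ?S M) \<alpha>s u = 0"
    by (simp add: covariant_deriv_def len tensor_upd)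
qed

end
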